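(* As $t\to\infty$, $\;t^2\log t\ll|\mathcal{R}_2(t)|\ll t^2\log t$; that is, there are constants $c_1,c_2>0$ and $t_0\geq 1$ such that $c_1 t^2\log t\leq |\mathcal{R}_2(t)|\leq c_2 t^2\log t$ for all $t\geq t_0$.
   Context: For a polynomial $p(X)=a_nX^n+\cdots+a_1X+a_0\in\mathbb{Z}[X]$ its height is $H(p)=\max\{|a_i| : i=0,\dots,n\}$. For real $t\geq 1$, $\mathcal{R}_2(t)$ denotes the set of all polynomials $p(X)\in\mathbb{Z}[X]$ of degree exactly $2$ with $H(p)\leq t$ which are reducible in $\mathbb{Q}[X]$. *)

theory Defs
  imports Complex_Main "HOL-Computational_Algebra.Polynomial"
begin

definition height :: "int poly \<Rightarrow> int" where
  "height p = Max ((\<lambda>i. \<bar>coeff p i\<bar>) ` {..degree p})"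

text \<open>A polynomial of degree 2 is neither zero nor a unit of \<open>\<rat>[X]\<close>, so here reducible is the
  negation of irreducible. Reducibility is over \<open>\<rat>\<close>: a nontrivial content of \<open>p\<close>
  does not make it reducible.\<close>

definition R2 :: "real \<Rightarrow> int poly set" where
  "R2 t = {p. degree p = 2 \<and> of_int (height p) \<le> t \<and>
              \<not> irreducible (map_poly of_int p :: rat poly)}"

text \<open>Finiteness ensures that \<open>card (R2 t)\<close> is the actual number of elements.\<close>

lemma abs_coeff_le_height: "\<bar>coeff p i\<bar> \<le> height p"
proof (cases "i \<le> degree p")
  case True
  then show ?thesis unfolding height_def by (intro Max_ge) auto
next
  case False
  have "\<bar>coeff p 0\<bar> \<le> height p" unfolding height_def by (intro Max_ge) auto
  with False show ?thesis by (simp add: coeff_eq_0)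
qed

lemma finite_R2: "finite (R2 t)"
proof -
  let ?I = "{- \<lfloor>t\<rfloor>..\<lfloor>t\<rfloor>}"
  have "p \<in> (\<lambda>(a, b, c). [:c, b, a:]) ` (?I \<times> ?I \<times> ?I)" if "p \<in> R2 t" for p
  proof -
    have deg: "degree p = 2" and "height p \<le> \<lfloor>t\<rfloor>"
      using that by (auto simp: R2_def le_floor_iff)
    then have bnd: "coeff p i \<in> ?I" for i
      using abs_coeff_le_height[of p i] by auto
    have "p = [:coeff p 0, coeff p 1, coeff p 2:]"
      using deg by (intro poly_eqI)
        (auto simp: coeff_pCons numeral_2_eq_2 coeff_eq_0 split: nat.split)
    with bnd show ?thesis
      by (intro image_eqI[of _ _ "(coeff p 2, coeff p 1, coeff p 0)"]) auto
  qed
  then have "R2 t \<subseteq> (\<lambda>(a, b, c). [:c, b, a:]) ` (?I \<times> ?I \<times> ?I)" by blast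
  then show ?thesis by (rule finite_subset) auto
qed

end

theory Submission
  imports Defs "HOL-Analysis.Harmonic_Numbers" "HOL-Number_Theory.Totient"
begin

text \<open>A reducible quadratic has a rational root, hence splits as \<open>(u X + v) (g X + k)\<close> over
  \<open>\<int>\<close>, and the product of the heights of the two factors is at most \<open>2 t\<close>. There are
  \<open>O(m)\<close> factors of height \<open>m\<close>, each admitting \<open>O((t/m)\<^sup>2)\<close> cofactors; summing
  \<open>t\<^sup>2/m\<close> over \<open>m \<le> 2 t\<close> gives the upper bound. For the lower bound one takes coprime
  \<open>v \<le> u\<close> and \<open>g \<le> m < k \<le> 2 m\<close> with \<open>m = \<lfloor>t/(4 u)\<rfloor>\<close>. These products are
  pairwise distinct, and their number is of order at least \<open>t\<^sup>2 \<Sum>u\<le>t/4. \<phi>(u)/u\<^sup>2\<close>, a sum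
  which is comparable to the harmonic sum.\<close>

section \<open>Harmonic sums and the totient function\<close>

text \<open>The difference \<open>harm n - ln n\<close> is decreasing and equals 1 at
  \<open>n = 1\<close>.\<close>

lemma harm_le_ln:
  assumes "n > 0"
  shows "harm n \<le> 1 + ln (real n)"
proof -
  obtain m where m: "n = Suc m"
    using assms gr0_implies_Suc by blast
  have "harm (Suc m) - ln (real (Suc m)) \<le> harm (Suc 0) - ln (real (Suc 0))"
    using decseq_harm_diff_ln by (rule decseqD) simp
  then show ?thesis
    by (simp add: m harm_def)
qed

text \<open>Each term with \<open>e \<ge> 2\<close> is at most \<open>1/(e - 1) - 1/e\<close>, which
  telescopes. The induction needs the sharper bound with \<open>1 / real (Suc k)\<close>
  subtracted.\<close>

lemma sum_inverse_squares_le: "(\<Sum>e=1..n. 1 / (real e)\<^sup>2) \<le> 2"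
proof -
  have "(\<Sum>e=1..Suc k. 1 / (real e)\<^sup>2) \<le> 2 - 1 / real (Suc k)" for k
  proof (induction k)
    case (Suc k)
    have "1 / (real (Suc (Suc k)))\<^sup>2 \<le> 1 / (real (Suc k) * real (Suc (Suc k)))"
      unfolding power2_eq_square by (intro divide_left_mono mult_right_mono) auto
    also have "\<dots> = 1 / real (Suc k) - 1 / real (Suc (Suc k))"
      by (simp add: field_simps)
    finally show ?case
      using Suc by simp
  qed simp
  moreover have "2 - 1 / real (Suc k) \<le> 2" for k
    by simp
  ultimately have "(\<Sum>e=1..Suc k. 1 / (real e)\<^sup>2) \<le> 2" for k
    by (rule order_trans)
  then show ?thesis
    by (cases n) (simp, blast)
qed

text \<open>The idea is to expand \<open>1/u = (\<Sum>d dvd u. \<phi> d) / u\<^sup>2\<close> and to write \<open>u = d e\<close>.\<close>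

lemma harm_le_sum_totient: "harm n \<le> 2 * (\<Sum>u=1..n. real (totient u) / (real u)\<^sup>2)"
proof -
  let ?T = "\<lambda>u. real (totient u) / (real u)\<^sup>2"
  let ?A = "Sigma {1..n} (\<lambda>u. {d. d dvd u})"
  let ?f = "\<lambda>(u, d). (d, u div d)"
  let ?g = "\<lambda>(d, e). ?T d * (1 / (real e)\<^sup>2)"
  have inj: "inj_on ?f ?A"
    by (auto simp: inj_on_def)
  have sub: "?f ` ?A \<subseteq> {1..n} \<times> {1..n}"
  proof clarsimp
    fix u d :: nat
    assume u: "Suc 0 \<le> u" "u \<le> n" and "d dvd u"
    then obtain e where "u = d * e" by blast
    with u have "d > 0" "e > 0" "d \<le> u" "e \<le> u" "u div d = e" by auto
    then show "Suc 0 \<le> d \<and> d \<le> n \<and> Suc 0 \<le> u div d \<and> u div d \<le> n"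
      using u by simp
  qed
  have "harm n = (\<Sum>u=1..n. \<Sum>d | d dvd u. real (totient d) / (real u)\<^sup>2)"
    unfolding harm_def
  proof (rule sum.cong[OF refl])
    fix u :: nat assume "u \<in> {1..n}"
    then have "(\<Sum>d | d dvd u. real (totient d)) = real u"
      using totient_divisor_sum[of u] by (metis of_nat_sum)
    then show "inverse (of_nat u) = (\<Sum>d | d dvd u. real (totient d) / (real u)\<^sup>2)"
      using \<open>u \<in> {1..n}\<close>
      by (simp add: sum_divide_distrib[symmetric] power2_eq_square field_simps)
  qed
  also have "\<dots> = (\<Sum>(u, d)\<in>?A. real (totient d) / (real u)\<^sup>2)"
    by (rule sum.Sigma) auto
  also have "\<dots> = (\<Sum>x\<in>?A. ?g (?f x))"
  proof (rule sum.cong[OF refl])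
    fix x assume "x \<in> ?A"
    then obtain d e where x: "x = (d * e, d)" and "d * e > 0"
      by (cases x) (auto elim!: dvdE)
    then show "(case x of (u, d) \<Rightarrow> real (totient d) / (real u)\<^sup>2) = ?g (?f x)"
      by (simp add: power_mult_distrib)
  qed
  also have "\<dots> = (\<Sum>y\<in>?f ` ?A. ?g y)"
    using sum.reindex[OF inj, of ?g] by (simp add: comp_def)
  \<comment> \<open>The image holds the pairs with \<open>d * e \<le> n\<close>. Filling up the
    square adds only nonnegative terms and lets the sum factor.\<close>
  also have "\<dots> \<le> (\<Sum>y\<in>{1..n} \<times> {1..n}. ?g y)"
    using sub by (intro sum_mono2) auto
  also have "\<dots> = (\<Sum>d=1..n. ?T d) * (\<Sum>e=1..n. 1 / (real e)\<^sup>2)"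
    by (simp add: sum_product sum.cartesian_product)
  also have "\<dots> \<le> (\<Sum>d=1..n. ?T d) * 2"
    by (intro mult_left_mono sum_inverse_squares_le sum_nonneg) auto
  finally show ?thesis by simp
qed

section \<open>Reducible quadratics as products of integer linear factors\<close>

lemma linear_product:
  fixes u v g k :: "'a::comm_semiring_1"
  shows "[:v, u:] * [:k, g:] = [:v * k, u * k + v * g, u * g:]"
  by (simp add: algebra_simps)

lemma height_quadratic_le_iff:
  assumes "a \<noteq> 0"
  shows "height [:c, b, a:] \<le> n \<longleftrightarrow> \<bar>a\<bar> \<le> n \<and> \<bar>b\<bar> \<le> n \<and> \<bar>c\<bar> \<le> n"
proof -
  have "{..degree [:c, b, a:]} = {0, 1, 2}"
    using assms by auto
  then show ?thesis
    by (auto simp: height_def numeral_2_eq_2)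
qed

text \<open>Two nonconstant factors already force degree 2 and reducibility, so only the height
  condition remains. The floor turns it into an inequality between integers.\<close>

lemma linear_product_mem_R2_iff:
  fixes u v g k :: int
  assumes "u \<noteq> 0" "g \<noteq> 0"
  shows "[:v, u:] * [:k, g:] \<in> R2 t \<longleftrightarrow>
    \<bar>u * g\<bar> \<le> \<lfloor>t\<rfloor> \<and> \<bar>u * k + v * g\<bar> \<le> \<lfloor>t\<rfloor> \<and> \<bar>v * k\<bar> \<le> \<lfloor>t\<rfloor>"
proof -
  let ?p = "[:rat_of_int v, of_int u:]" and ?q = "[:rat_of_int k, of_int g:]"
  have "map_poly of_int ([:v, u:] * [:k, g:]) = ?p * ?q"
    unfolding linear_product by (simp add: map_poly_pCons)
  moreover have "\<not> is_unit ?p" "\<not> is_unit ?q"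
    using assms by (simp_all add: is_unit_iff_degree)
  ultimately have "\<not> irreducible (map_poly of_int ([:v, u:] * [:k, g:]) :: rat poly)"
    using irreducibleD by metis
  moreover have "degree ([:v, u:] * [:k, g:]) = 2"
    unfolding linear_product using assms by simp
  moreover have "of_int (height ([:v, u:] * [:k, g:])) \<le> t \<longleftrightarrow>
      \<bar>u * g\<bar> \<le> \<lfloor>t\<rfloor> \<and> \<bar>u * k + v * g\<bar> \<le> \<lfloor>t\<rfloor> \<and> \<bar>v * k\<bar> \<le> \<lfloor>t\<rfloor>"
    unfolding linear_product le_floor_iff[symmetric]
    using assms by (intro height_quadratic_le_iff) simp
  ultimately show ?thesis
    unfolding R2_def by simp
qed

text \<open>The degrees of two nonunit factors are positive and add up to 2, so both factors are
  linear.\<close>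

lemma reducible_quadratic_imp_root:
  fixes p :: "'a::field poly"
  assumes "degree p = 2" "\<not> irreducible p"
  obtains x where "poly p x = 0"
proof -
  have "p \<noteq> 0"
    using assms(1) by auto
  moreover from this have "\<not> is_unit p"
    using assms(1) by (simp add: is_unit_iff_degree)
  ultimately obtain a b where ab: "p = a * b" "\<not> is_unit a" "\<not> is_unit b"
    using assms(2) unfolding irreducible_def by blast
  then have "a \<noteq> 0" "b \<noteq> 0"
    using \<open>p \<noteq> 0\<close> by auto
  then have "degree a + degree b = 2" "degree a \<noteq> 0" "degree b \<noteq> 0"
    using ab assms(1) by (auto simp: degree_mult_eq is_unit_iff_degree)
  then have "degree a = 1"
    by simp
  then obtain c d where a: "a = [:c, d:]" "d \<noteq> 0"
    by (cases a) (auto split: if_splits elim!: degree_eq_zeroE)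
  then have "poly p (- c / d) = 0"
    by (simp add: ab)
  then show ?thesis
    by (rule that)
qed

text \<open>This is Gauss's lemma done by hand: for a root \<open>w/u\<close> in lowest terms,
  \<open>u X - w\<close> divides \<open>p\<close> over the integers. Any content of \<open>p\<close>
  ends up in the cofactor.\<close>

lemma mem_R2_imp_linear_product:
  assumes "p \<in> R2 t"
  obtains u v g k :: int where "u \<noteq> 0" "g \<noteq> 0" "p = [:v, u:] * [:k, g:]"
proof -
  have deg: "degree p = 2" and red: "\<not> irreducible (map_poly of_int p :: rat poly)"
    using assms by (auto simp: R2_def)
  define A B C where ABC: "A = coeff p 2" "B = coeff p 1" "C = coeff p 0"
  have p: "p = [:C, B, A:]"
    using deg by (intro poly_eqI)
      (auto simp: ABC coeff_pCons numeral_2_eq_2 coeff_eq_0 split: nat.split)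
  have "A \<noteq> 0"
    using deg by (auto simp: p split: if_splits)
  have "degree (map_poly of_int p :: rat poly) = 2"
    using \<open>A \<noteq> 0\<close> by (simp add: p map_poly_pCons)
  from reducible_quadratic_imp_root[OF this red] obtain x :: rat
    where x: "poly (map_poly of_int p) x = 0" .
  obtain w u where wu: "quotient_of x = (w, u)"
    by fastforce
  have "u > 0" "coprime w u" "x = of_int w / of_int u"
    using quotient_of_denom_pos[OF wu] quotient_of_coprime[OF wu] quotient_of_div[OF wu] by auto
  have "of_int C + x * (of_int B + x * of_int A) = 0"
    using x by (simp add: p map_poly_pCons)
  then have "rat_of_int (C * u\<^sup>2 + w * (B * u + w * A)) = 0"
    using \<open>u > 0\<close> unfolding \<open>x = _\<close> by (simp add: field_simps power2_eq_square)
  then have eq: "C * u\<^sup>2 + w * (B * u + w * A) = 0"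
    using of_int_eq_0_iff by blast
  \<comment> \<open>Reducing the cleared equation modulo \<open>u\<close> and cancelling
    \<open>w\<close> gives \<open>u dvd A\<close>. After division by \<open>u\<close>, the same
    argument yields \<open>k\<close>.\<close>
  have "u dvd w * (w * A)"
  proof
    show "w * (w * A) = u * (- C * u - w * B)"
      using eq by (simp add: algebra_simps power2_eq_square)
  qed
  then obtain g where g: "A = u * g"
    using \<open>coprime w u\<close> by (metis coprime_commute coprime_dvd_mult_right_iff dvdE)
  have "u * (C * u + w * (B + w * g)) = 0"
    using eq unfolding g by (simp add: algebra_simps power2_eq_square)
  then have eq2: "C * u + w * (B + w * g) = 0"
    using \<open>u > 0\<close> by simp
  have "u dvd w * (B + w * g)"
  proof
    show "w * (B + w * g) = u * (- C)"
      using eq2 by (simp add: algebra_simps)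
  qed
  then obtain k where k: "B + w * g = u * k"
    using \<open>coprime w u\<close> by (metis coprime_commute coprime_dvd_mult_right_iff dvdE)
  have "u * (C + w * k) = 0"
    using eq2 unfolding k by (simp add: algebra_simps)
  then have "C = (- w) * k"
    using \<open>u > 0\<close> by simp
  moreover have "B = u * k + (- w) * g"
    using k by simp
  ultimately have "p = [:- w, u:] * [:k, g:]"
    unfolding linear_product p g by simp
  moreover have "u \<noteq> 0" "g \<noteq> 0"
    using \<open>A \<noteq> 0\<close> g by auto
  ultimately show ?thesis
    using that by blast
qed

section \<open>Upper bound\<close>

text \<open>If \<open>x\<close> exceeded \<open>2 * T\<close> in absolute value, the bound on
  \<open>x + y\<close> would push \<open>y\<close> beyond \<open>T\<close>, making the product too
  large.\<close>

lemma abs_le_of_abs_mult_le_abs_add_le: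
  fixes x y T :: int
  assumes "\<bar>x * y\<bar> \<le> T\<^sup>2" "\<bar>x + y\<bar> \<le> T"
  shows "\<bar>x\<bar> \<le> 2 * T"
proof (rule ccontr)
  assume "\<not> ?thesis"
  then have "\<bar>x\<bar> > T" "\<bar>y\<bar> > T" "T \<ge> 0"
    using assms(2) by linarith+
  then have "\<bar>x\<bar> * \<bar>y\<bar> > T * T"
    by (intro mult_strict_mono) auto
  then show False
    using assms(1) by (simp add: abs_mult power2_eq_square)
qed

text \<open>With \<open>x = v g\<close> and \<open>y = u k\<close>, the product \<open>x y\<close> of the two cross terms equals the
  product of the outer coefficients, and \<open>x + y\<close> is the middle coefficient.\<close>

lemma height_linear_product_le:
  fixes u v g k T :: int
  assumes "\<bar>u * g\<bar> \<le> T" "\<bar>u * k + v * g\<bar> \<le> T" "\<bar>v * k\<bar> \<le> T"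
  shows "max \<bar>u\<bar> \<bar>v\<bar> * max \<bar>g\<bar> \<bar>k\<bar> \<le> 2 * T"
proof -
  have "\<bar>(u * g) * (v * k)\<bar> \<le> T\<^sup>2"
    unfolding abs_mult[of "u * g"] power2_eq_square using assms by (intro mult_mono) auto
  then have "\<bar>(v * g) * (u * k)\<bar> \<le> T\<^sup>2" "\<bar>(u * k) * (v * g)\<bar> \<le> T\<^sup>2"
    by (simp_all add: ac_simps)
  then have "\<bar>v * g\<bar> \<le> 2 * T" "\<bar>u * k\<bar> \<le> 2 * T"
    using assms(2) by (auto intro: abs_le_of_abs_mult_le_abs_add_le simp: add.commute)
  moreover have "0 \<le> T"
    using assms(1) by linarith
  then have "\<bar>u * g\<bar> \<le> 2 * T" "\<bar>v * k\<bar> \<le> 2 * T"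
    using assms by linarith+
  \<comment> \<open>The product of the maxima is the absolute value of one of the four products just
    bounded.\<close>
  ultimately show ?thesis
    by (auto simp: max_def abs_mult)
qed

text \<open>The four sides of the square have \<open>2 * m + 1 \<le> 3 * m\<close> points
  each.\<close>

lemma card_max_norm_sphere_le:
  assumes "m > 0"
  shows "card {(u::int, v::int). max \<bar>u\<bar> \<bar>v\<bar> = int m} \<le> 12 * m" (is "card ?L \<le> _")
proof -
  let ?S = "{- int m, int m}" and ?I = "{- int m..int m}"
  have "card ?L \<le> card (?S \<times> ?I \<union> ?I \<times> ?S)"
    by (rule card_mono) (auto simp: max_def split: if_splits)
  also have "\<dots> \<le> card (?S \<times> ?I) + card (?I \<times> ?S)"
    by (rule card_Un_le)
  also have "\<dots> \<le> 12 * m"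
    using assms by (simp add: card_cartesian_product nat_add_distrib)
  finally show ?thesis .
qed

lemma card_R2_le:
  defines "N \<equiv> \<lambda>t. nat (2 * \<lfloor>t\<rfloor>)"
  shows "real (card (R2 t)) \<le> 108 * (real (N t))\<^sup>2 * harm (N t)"
proof -
  define n where "n = N t"
  \<comment> \<open>\<open>L m\<close> holds the first factors of height exactly \<open>m\<close>;
    \<open>n\<close> bounds the product of the two heights, so the cofactor has coefficients in
    \<open>I m\<close>.\<close>
  define L where "L = (\<lambda>m::nat. {(u::int, v::int). max \<bar>u\<bar> \<bar>v\<bar> = int m})"
  define I where "I = (\<lambda>m::nat. {- int (n div m)..int (n div m)})"
  define S where "S = (\<lambda>m. L m \<times> I m \<times> I m)"
  define f :: "(int \<times> int) \<times> int \<times> int \<Rightarrow> int poly"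
    where "f = (\<lambda>((u, v), (g, k)). [:v, u:] * [:k, g:])"
  have finL: "finite (L m)" for m
    by (rule finite_subset[of _ "{- int m..int m} \<times> {- int m..int m}"]) (auto simp: L_def)
  have finS: "finite (S m)" for m
    by (auto simp: S_def I_def finL)
  have "R2 t \<subseteq> f ` (\<Union>m\<in>{1..n}. S m)"
  proof
    fix p assume pR: "p \<in> R2 t"
    then obtain u v g k :: int
      where uv: "u \<noteq> 0" "g \<noteq> 0" and p: "p = [:v, u:] * [:k, g:]"
      by (rule mem_R2_imp_linear_product)
    define m where "m = nat (max \<bar>u\<bar> \<bar>v\<bar>)"
    define l where "l = nat (max \<bar>g\<bar> \<bar>k\<bar>)"
    have ml: "int m = max \<bar>u\<bar> \<bar>v\<bar>" "int l = max \<bar>g\<bar> \<bar>k\<bar>"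
      by (simp_all add: m_def l_def)
    have "int m * int l \<le> 2 * \<lfloor>t\<rfloor>"
      unfolding ml using pR uv by (intro height_linear_product_le)
        (simp_all add: p linear_product_mem_R2_iff del: mult_pCons_left mult_pCons_right)
    then have "m * l \<le> n"
      unfolding n_def N_def by (metis of_nat_mult nat_int nat_mono)
    moreover have "m \<ge> 1" "l \<ge> 1"
      using uv by (auto simp: m_def l_def)
    ultimately have "l \<le> n div m" "m \<le> n"
      by (simp_all add: less_eq_div_iff_mult_less_eq mult.commute)
         (metis \<open>m * l \<le> n\<close> \<open>1 \<le> l\<close> dual_order.trans mult_le_mono2 mult.right_neutral)
    then have "((u, v), (g, k)) \<in> S m" "m \<in> {1..n}"
      using ml \<open>m \<ge> 1\<close> by (auto simp: S_def L_def I_def)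
    then show "p \<in> f ` (\<Union>m\<in>{1..n}. S m)"
      by (intro image_eqI[of _ _ "((u, v), (g, k))"]) (auto simp: f_def p)
  qed
  then have "card (R2 t) \<le> card (f ` (\<Union>m\<in>{1..n}. S m))"
    using finS by (intro card_mono) auto
  also have "\<dots> \<le> card (\<Union>m\<in>{1..n}. S m)"
    using finS by (intro card_image_le) auto
  also have "\<dots> \<le> (\<Sum>m=1..n. card (S m))"
    by (rule card_UN_le) simp
  finally have "real (card (R2 t)) \<le> (\<Sum>m=1..n. real (card (S m)))"
    by (metis of_nat_le_iff of_nat_sum)
  also have "\<dots> \<le> (\<Sum>m=1..n. 108 * (real n)\<^sup>2 * inverse (real m))"
  proof (rule sum_mono)
    fix m assume m: "m \<in> {1..n}"
    then have "n div m \<ge> 1"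
      by (simp add: div_greater_zero_iff Suc_le_eq)
    then have "card (I m) \<le> 3 * (n div m)"
      by (simp add: I_def nat_add_distrib)
    then have I: "real (card (I m)) \<le> 3 * (real n / real m)"
      using of_nat_div_le_of_nat[of n m, where 'a=real] by linarith
    have "real (card (S m)) = real (card (L m)) * (real (card (I m)) * real (card (I m)))"
      by (simp add: S_def card_cartesian_product)
    also have "\<dots> \<le> (12 * real m) * ((3 * (real n / real m)) * (3 * (real n / real m)))"
      using card_max_norm_sphere_le[of m] m I
      by (intro mult_mono) (auto simp: L_def)
    \<comment> \<open>Here \<open>108 = 12 * 3 * 3\<close>, and \<open>m * (n/m)^2 = n^2/m\<close>
      produces the harmonic sum.\<close>
    also have "\<dots> = 108 * (real n)\<^sup>2 * inverse (real m)"
      using m by (simp add: field_simps power2_eq_square)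
    finally show "real (card (S m)) \<le> 108 * (real n)\<^sup>2 * inverse (real m)" .
  qed
  also have "\<dots> = 108 * (real n)\<^sup>2 * harm n"
    by (simp add: harm_def sum_distrib_left)
  finally show ?thesis
    by (simp add: n_def)
qed

section \<open>Lower bound\<close>

text \<open>The roots satisfy \<open>-k/g < -1 \<le> -v/u\<close>, so the product determines which factor is which.\<close>

lemma linear_product_unique:
  fixes u v g k u' v' g' k' :: nat
  assumes "coprime v u" "0 < v" "v \<le> u" "0 < g" "g < k"
    and "coprime v' u'" "0 < v'" "v' \<le> u'" "0 < g'" "g' < k'"
    and eq: "[:int v, int u:] * [:int k, int g:] = [:int v', int u':] * [:int k', int g':]"
  shows "u = u' \<and> v = v' \<and> g = g' \<and> k = k'"
proof -
  have co: "int v * int k = int v' * int k'" "int u * int g = int u' * int g'"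
    "int u * int k + int v * int g = int u' * int k' + int v' * int g'"
    using eq unfolding linear_product by auto
  \<comment> \<open>Up to the factor \<open>u^2\<close>, this evaluates the second product at the
    root \<open>-v/u\<close> of the first. The cofactor is positive there, so the roots
    \<open>-v/u\<close> and \<open>-v'/u'\<close> agree.\<close>
  have "(int v' * int u - int u' * int v) * (int k' * int u - int g' * int v) = 0"
    using co by algebra
  moreover have "int g' * int v < int k' * int u"
    using assms by (intro mult_less_le_imp_less) auto
  ultimately have "int v' * int u = int u' * int v"
    by simp
  then have vu: "v' * u = u' * v"
    by (metis of_nat_eq_iff of_nat_mult)
  then have "u = u' \<and> v = v'"
    using assms(1,6) by (metis coprime_crossproduct_nat coprime_commute mult.commute)
  moreover from this have "g = g'" "k = k'"
    using co assms by auto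
  ultimately show ?thesis
    by simp
qed

lemma card_R2_ge:
  assumes "t \<ge> 0"
  shows "real (card (R2 t)) \<ge> t\<^sup>2 / 128 * harm (nat \<lfloor>t / 4\<rfloor>)"
proof -
  define n where "n = nat \<lfloor>t / 4\<rfloor>"
  \<comment> \<open>This choice keeps all coefficients of the products at most
    \<open>4 * (u * M u) \<le> t\<close>, and \<open>u \<le> n\<close> ensures
    \<open>M u \<ge> 1\<close>.\<close>
  define M where "M = (\<lambda>u. nat \<lfloor>t / (4 * real u)\<rfloor>)"
  \<comment> \<open>The disjoint ranges of \<open>g\<close> and \<open>k\<close> force
    \<open>g < k\<close>, as uniqueness of the factorization requires.\<close>
  define S where "S = Sigma {1..n} (\<lambda>u. totatives u \<times> {1..M u} \<times> {M u + 1..2 * M u})"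
  define f :: "nat \<times> nat \<times> nat \<times> nat \<Rightarrow> int poly"
    where "f = (\<lambda>(u, v, g, k). [:int v, int u:] * [:int k, int g:])"
  have inj: "inj_on f S"
  proof (rule inj_onI)
    fix x y assume xy: "x \<in> S" "y \<in> S" "f x = f y"
    obtain u v g k where x: "x = (u, v, g, k)" by (metis surj_pair)
    obtain u' v' g' k' where y: "y = (u', v', g', k')" by (metis surj_pair)
    have "u = u' \<and> v = v' \<and> g = g' \<and> k = k'"
    proof (rule linear_product_unique)
      show "[:int v, int u:] * [:int k, int g:] = [:int v', int u':] * [:int k', int g':]"
        using xy(3) by (simp only: x y f_def prod.case)
    qed (use xy(1,2) in \<open>auto simp: x y S_def totatives_def\<close>)
    then show "x = y" by (simp add: x y)
  qed
  have "f ` S \<subseteq> R2 t"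
  proof clarify
    fix u v g k assume "(u, v, g, k) \<in> S"
    then have u: "1 \<le> u" "1 \<le> v" "v \<le> u" "1 \<le> g" "g \<le> M u" "1 \<le> k" "k \<le> 2 * M u"
      by (auto simp: S_def totatives_def)
    have "real (M u) \<le> t / (4 * real u)"
      using assms by (simp add: M_def)
    then have "real (4 * (u * M u)) \<le> t"
      using u by (simp add: field_simps)
    then have "int (4 * (u * M u)) \<le> \<lfloor>t\<rfloor>"
      by (simp add: le_floor_iff)
    moreover have le: "u * g \<le> u * M u" "u * k \<le> u * (2 * M u)" "v * g \<le> u * M u"
      "v * k \<le> u * (2 * M u)"
      using u by (auto intro!: mult_le_mono)
    have "u * g \<le> 4 * (u * M u)" "u * k + v * g \<le> 4 * (u * M u)" "v * k \<le> 4 * (u * M u)"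
      using le by linarith+
    ultimately have "int (u * g) \<le> \<lfloor>t\<rfloor>" "int (u * k + v * g) \<le> \<lfloor>t\<rfloor>" "int (v * k) \<le> \<lfloor>t\<rfloor>"
      by linarith+
    moreover have "int u \<noteq> 0" "int g \<noteq> 0"
      using u by auto
    ultimately have "[:int v, int u:] * [:int k, int g:] \<in> R2 t"
      by (subst linear_product_mem_R2_iff) simp_all
    then show "f (u, v, g, k) \<in> R2 t"
      by (simp only: f_def prod.case)
  qed
  then have "card S \<le> card (R2 t)"
    using card_inj_on_le[OF inj] finite_R2 by blast
  moreover have "card S = (\<Sum>u=1..n. totient u * (M u * M u))"
    unfolding S_def by (subst card_SigmaI) (auto simp: card_cartesian_product totient_def)
  ultimately have card: "(\<Sum>u=1..n. real (totient u) * (real (M u))\<^sup>2) \<le> real (card (R2 t))"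
    by (metis (no_types, lifting) of_nat_le_iff of_nat_sum of_nat_mult power2_eq_square sum.cong)
  have "t\<^sup>2 / 128 * harm n \<le> t\<^sup>2 / 128 * (2 * (\<Sum>u=1..n. real (totient u) / (real u)\<^sup>2))"
    by (intro mult_left_mono harm_le_sum_totient) auto
  also have "\<dots> = (\<Sum>u=1..n. real (totient u) * (t / (8 * real u))\<^sup>2)"
    unfolding sum_distrib_left by (intro sum.cong) (auto simp: field_simps power2_eq_square)
  \<comment> \<open>Rounding a real \<open>x \<ge> 1\<close> down loses at most a factor 2, hence
    \<open>8\<close> in place of \<open>4\<close>; this gives \<open>2/128 = 1/8^2\<close>.\<close>
  also have "\<dots> \<le> (\<Sum>u=1..n. real (totient u) * (real (M u))\<^sup>2)"
  proof (intro sum_mono mult_left_mono power_mono)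
    fix u assume u: "u \<in> {1..n}"
    then have "real u \<le> t / 4"
      using assms by (simp add: n_def) linarith
    then have "t / (4 * real u) \<ge> 1"
      using u by (simp add: field_simps)
    moreover have "x \<le> 2 * real (nat \<lfloor>x\<rfloor>)" if "x \<ge> 1" for x :: real
    proof -
      have "\<lfloor>x\<rfloor> \<ge> 1"
        using that by simp
      then have "real (nat \<lfloor>x\<rfloor>) = of_int \<lfloor>x\<rfloor>" "real_of_int \<lfloor>x\<rfloor> \<ge> 1"
        by simp_all
      then show ?thesis
        using floor_correct[of x] by linarith
    qed
    ultimately have "t / (4 * real u) \<le> 2 * real (M u)"
      unfolding M_def by blast
    then show "t / (8 * real u) \<le> real (M u)"
      by (simp add: field_simps)
  qed (use assms in auto)
  also note card
  finally show ?thesis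
    by (simp add: n_def)
qed

section \<open>Explicit constants for both bounds\<close>

theorem theorem2:
  shows "\<exists>(c1::real)>0. \<exists>(c2::real)>0. \<exists>(t0::real)\<ge>1. \<forall>t\<ge>t0.
    c1 * t\<^sup>2 * ln t \<le> real (card (R2 t)) \<and> real (card (R2 t)) \<le> c2 * t\<^sup>2 * ln t"
proof -
  \<comment> \<open>The threshold \<open>16 = 4^2\<close> gives
    \<open>ln (t/4) \<ge> ln t / 2\<close>, whence \<open>256 = 2 * 128\<close>. Above,
    \<open>N \<le> 2 * t\<close> and \<open>harm N \<le> 3 * ln t\<close> give
    \<open>1296 = 108 * 4 * 3\<close>.\<close>
  have "1 / 256 * t\<^sup>2 * ln t \<le> real (card (R2 t)) \<and> real (card (R2 t)) \<le> 1296 * t\<^sup>2 * ln t"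
    if t: "t \<ge> 16" for t :: real
  proof
    have "ln 16 \<le> ln t"
      using t by simp
    moreover have ln16: "ln 16 = 4 * ln (2::real)"
      using ln_realpow[of 2 4] by simp
    ultimately have lnt: "ln t \<ge> 4 * ln 2"
      by simp
    have "ln t / 2 \<le> ln t - 2 * ln 2"
      using lnt by simp
    also have "\<dots> = ln (t / 4)"
      using t ln_realpow[of 2 2] by (simp add: ln_div)
    also have "\<dots> \<le> ln (real (nat \<lfloor>t / 4\<rfloor>) + 1)"
      using t by (intro ln_mono) linarith+
    also have "\<dots> \<le> harm (nat \<lfloor>t / 4\<rfloor>)"
      by (rule ln_le_harm)
    finally have "t\<^sup>2 / 128 * (ln t / 2) \<le> t\<^sup>2 / 128 * harm (nat \<lfloor>t / 4\<rfloor>)"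
      by (rule mult_left_mono) simp
    also have "\<dots> \<le> real (card (R2 t))"
      using t by (intro card_R2_ge) simp
    finally show "1 / 256 * t\<^sup>2 * ln t \<le> real (card (R2 t))"
      by simp
    define N where "N = nat (2 * \<lfloor>t\<rfloor>)"
    have N: "N > 0" "real N \<le> 2 * t"
      using t unfolding N_def by linarith+
    have "harm N \<le> 1 + ln (real N)"
      using N by (intro harm_le_ln)
    also have "\<dots> \<le> 1 + ln (2 * t)"
      using N t by simp
    also have "\<dots> = 1 + ln 2 + ln t"
      using t by (simp add: ln_mult)
    also have "\<dots> \<le> 3 * ln t"
      using lnt ln2_ge_two_thirds by linarith
    finally have "harm N \<le> 3 * ln t" .
    then have "108 * (real N)\<^sup>2 * harm N \<le> 108 * (2 * t)\<^sup>2 * (3 * ln t)"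
      using N by (intro mult_mono power_mono) (auto simp: harm_nonneg)
    also have "\<dots> = 1296 * t\<^sup>2 * ln t"
      by (simp add: power_mult_distrib)
    finally show "real (card (R2 t)) \<le> 1296 * t\<^sup>2 * ln t"
      using card_R2_le[of t] unfolding N_def by (rule order_trans[rotated])
  qed
  then show ?thesis
    by (intro exI[of _ "1 / 256"] exI[of _ 1296] exI[of _ 16] conjI allI impI) auto
qed

end
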